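(* Let $(X,\mathcal{B},\mu,T)$ be a m.d.s. Then the following are equivalent: (1) $(X,\mathcal{B},\mu,T)$ is weakly mixing; (2) $(X,\mathcal{B},\mu,T)$ is $\mathcal{F}_{\inf}$-independent of order $2$; (3) $(X,\mathcal{B},\mu,T)$ is $\mathcal{F}_{\inf}$-independent; (4) $(X,\mathcal{B},\mu,T)$ is $\mathcal{F}_{\mathrm{ip}}$-independent of order $2$; (5) $(X,\mathcal{B},\mu,T)$ is $\mathcal{F}_{\mathrm{ip}}$-independent.
   Context: $\mathbb{Z}_+=\{0,1,2,\dots\}$, $\mathbb{N}=\{1,2,\dots\}$. A m.d.s. $(X,\mathcal{B},\mu,T)$ consists of a Lebesgue space $(X,\mathcal{B},\mu)$ (i.e. $\mathcal{B}$ is the Borel $\sigma$-algebra of some Polish topology on $X$ and $\mu$ is a probability measure on $\mathcal{B}$) and a measurable map $T:X\to X$ with $\mu(T^{-1}B)=\mu(B)$ for all $B\in\mathcal{B}$ ($T$ need not be invertible). For $A,B\in\mathcal{B}$, $N(A,B)=\{n\in\mathbb{Z}_+:\mu(A\cap T^{-n}B)>0\}$. The m.d.s. is ergodic if $N(A,B)\neq\emptyset$ for all $A,B\in\mathcal{B}$ of positive measure; it is weakly mixing if $T\times T$ (with $\mu\times\mu$) is ergodic. A set $F\subseteq\mathbb{Z}_+$ is an independence set for a tuple $(A_1,\dots,A_k)$ of sets in $\mathcal{B}$ if for every nonempty finite $J\subseteq F$ and every $s\in\{1,\dots,k\}^J$ one has $\mu(\bigcap_{j\in J}T^{-j}A_{s(j)})>0$.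 $\mathrm{Ind}(A_1,\dots,A_k)$ denotes the collection of all such independence sets. A family is an upward-hereditary collection of subsets of $\mathbb{Z}_+$. For a family $\mathcal{F}$ and $k\in\mathbb{N}$, the m.d.s. is $\mathcal{F}$-independent of order $k$ if $\mathrm{Ind}(A_1,\dots,A_k)\cap\mathcal{F}\neq\emptyset$ for all $A_1,\dots,A_k\in\mathcal{B}$ of positive measure; it is $\mathcal{F}$-independent if it is so of order $k$ for every $k\in\mathbb{N}$. $\mathcal{F}_{\inf}$ is the family of all infinite subsets of $\mathbb{Z}_+$. An IP-set is a set of the form $\{a_{n_1}+\dots+a_{n_k}: k\in\mathbb{N},\ n_1<\dots<n_k\}$ for some sequence $\{a_n\}_{n\in\mathbb{N}}$ in $\mathbb{N}$; $\mathcal{F}_{\mathrm{ip}}$ is the family of all subsets of $\mathbb{Z}_+$ containing an IP-set. *)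

theory Defs
  imports "HOL-Probability.Probability"
begin

definition polish_topology :: "'a topology \<Rightarrow> bool" where
  "polish_topology X \<longleftrightarrow> separable_space X \<and> completely_metrizable_space X"

locale lebesgue_prob_space = prob_space M for M :: "'a measure" +
  assumes polish: "\<exists>X. polish_topology X \<and> topspace X = space M \<and>
    sets M = sigma_sets (space M) {U. openin X U}"

locale mds = lebesgue_prob_space M for M :: "'a measure" +
  fixes T :: "'a \<Rightarrow> 'a"
  assumes measurable_T: "T \<in> measurable M M"
    and preserves: "B \<in> sets M \<Longrightarrow> measure M (T -` B \<inter> space M) = measure M B"

text \<open>Inverse images are cut down to \<^term>\<open>space M\<close>, since \<^term>\<open>T\<close> is a total function on the
  underlying type.\<close>

definition preimage_pow :: "'a measure \<Rightarrow> ('a \<Rightarrow> 'a) \<Rightarrow> nat \<Rightarrow> 'a set \<Rightarrow> 'a set" where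
  "preimage_pow M T n B = (T ^^ n) -` B \<inter> space M"

definition hitting_times :: "'a measure \<Rightarrow> ('a \<Rightarrow> 'a) \<Rightarrow> 'a set \<Rightarrow> 'a set \<Rightarrow> nat set" where
  "hitting_times M T A B = {n. measure M (A \<inter> preimage_pow M T n B) > 0}"

definition ergodic :: "'a measure \<Rightarrow> ('a \<Rightarrow> 'a) \<Rightarrow> bool" where
  "ergodic M T \<longleftrightarrow>
    (\<forall>A \<in> sets M. \<forall>B \<in> sets M. measure M A > 0 \<longrightarrow> measure M B > 0 \<longrightarrow> hitting_times M T A B \<noteq> {})"

definition weakly_mixing :: "'a measure \<Rightarrow> ('a \<Rightarrow> 'a) \<Rightarrow> bool" where
  "weakly_mixing M T \<longleftrightarrow> ergodic (M \<Otimes>\<^sub>M M) (map_prod T T)"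

text \<open>A tuple \<open>(A\<^sub>1, \<dots>, A\<^sub>k)\<close> is a function \<^term>\<open>A\<close> on \<^typ>\<open>nat\<close> of which only the values
  on \<^term>\<open>{1..k}\<close> matter.\<close>

definition Ind :: "'a measure \<Rightarrow> ('a \<Rightarrow> 'a) \<Rightarrow> nat \<Rightarrow> (nat \<Rightarrow> 'a set) \<Rightarrow> nat set set" where
  "Ind M T k A = {F. \<forall>J s. J \<subseteq> F \<longrightarrow> finite J \<longrightarrow> J \<noteq> {} \<longrightarrow> s \<in> J \<rightarrow> {1..k} \<longrightarrow>
    measure M (\<Inter>j\<in>J. preimage_pow M T j (A (s j))) > 0}"

definition independent_of_order ::
    "'a measure \<Rightarrow> ('a \<Rightarrow> 'a) \<Rightarrow> nat set set \<Rightarrow> nat \<Rightarrow> bool" where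
  "independent_of_order M T \<F> k \<longleftrightarrow>
    (\<forall>A. (\<forall>i \<in> {1..k}. A i \<in> sets M \<and> measure M (A i) > 0) \<longrightarrow> Ind M T k A \<inter> \<F> \<noteq> {})"

definition independent_all_orders :: "'a measure \<Rightarrow> ('a \<Rightarrow> 'a) \<Rightarrow> nat set set \<Rightarrow> bool" where
  "independent_all_orders M T \<F> \<longleftrightarrow> (\<forall>k\<ge>1. independent_of_order M T \<F> k)"

definition is_family :: "nat set set \<Rightarrow> bool" where
  "is_family \<F> \<longleftrightarrow> (\<forall>F \<in> \<F>. \<forall>G. F \<subseteq> G \<longrightarrow> G \<in> \<F>)"

definition family_inf :: "nat set set" where
  "family_inf = {F. infinite F}"

text \<open>The sums over \<open>n\<^sub>1 < \<dots> < n\<^sub>k\<close> with \<open>k \<ge> 1\<close> are the sums over finite nonempty index sets;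
  sequences are indexed from 0.\<close>

definition is_IP_set :: "nat set \<Rightarrow> bool" where
  "is_IP_set F \<longleftrightarrow>
    (\<exists>a :: nat \<Rightarrow> nat. (\<forall>n. a n \<ge> 1) \<and> F = {\<Sum>n\<in>I. a n | I. finite I \<and> I \<noteq> {}})"

definition family_ip :: "nat set set" where
  "family_ip = {F. \<exists>P \<subseteq> F. is_IP_set P}"

lemma is_family_inf: "is_family family_inf"
  unfolding is_family_def family_inf_def using infinite_super by blast

lemma is_family_ip: "is_family family_ip"
  unfolding is_family_def family_ip_def by blast

end

theory Submission
  imports Defs
begin

text \<open>
  Since every IP-set is infinite, independence of all orders along IP-sets is the strongest of the
  four independence properties and independence of order 2 along infinite sets the weakest. So two
  implications remain: weak mixing gives independence along IP-sets of every order, and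
  independence of order 2 along infinite sets gives weak mixing. Write \<open>N(A, B)\<close> for the set of
  hitting times.

  \<^bold>\<open>Weak mixing gives IP-independence.\<close> Ergodicity of \<open>T \<times> T\<close>, applied to rectangles, says that the
  sets of hitting times of any two pairs of sets of positive measure meet. A trick of Furstenberg
  upgrades this: if
  \<open>n \<in> N(A\<^sub>1, A\<^sub>2) \<inter> N(B\<^sub>1, B\<^sub>2)\<close>, then the pair of sets \<open>A\<^sub>1 \<inter> T\<^sup>-\<^sup>n A\<^sub>2\<close> and \<open>B\<^sub>1 \<inter> T\<^sup>-\<^sup>n B\<^sub>2\<close>
  has its hitting times in \<open>N(A\<^sub>1, B\<^sub>1) \<inter> N(A\<^sub>2, B\<^sub>2)\<close>. Hence finitely many sets of hitting times
  always have a common element \<open>\<ge> 1\<close> (\<open>common_positive_hitting_time\<close>). Given a finite independence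
  set \<open>F\<close>, a common hitting time \<open>a\<close> of all the pairs of positive-measure cylinders over \<open>F\<close> makes
  \<open>F \<union> (a + F)\<close> an independence set (\<open>Ind_extend\<close>). Starting from \<open>{0}\<close>, the successive
  translations \<open>a\<close> generate an IP-set.

  \<^bold>\<open>Independence of order 2 gives weak mixing.\<close> Two elements \<open>j < k\<close> of an independence set of
  \<open>(A, B)\<close> give \<open>k - j \<in> N(A, A) \<inter> N(A, B)\<close>, so these two sets of hitting times always meet. If
  \<open>T \<times> T\<close> is not ergodic, there is a strictly \<open>T \<times> T\<close>-invariant set \<open>D\<close> of measure strictly between
  0 and 1. Let \<open>D\<^sub>x\<close> be its section at \<open>x\<close>. Since \<open>T\<^sup>-\<^sup>1 D\<^bsub>Tx\<^esub> = D\<^sub>x\<close>, the map \<open>T\<close> is an isometry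
  of the pseudometric \<open>d(x, y) = \<mu>(D\<^sub>x \<triangle> D\<^sub>y)\<close>. This pseudometric is separable
  (\<open>countable_dense_sections\<close>), so almost every point lies in arbitrarily small pieces of positive
  measure. A common element of \<open>N(A, A)\<close> and \<open>N(A, B)\<close>, for two such pieces, sends one point of
  \<open>A\<close> to \<open>A\<close> and another to \<open>B\<close>; as the two points stay equally close, \<open>A\<close> and \<open>B\<close> are close
  together. So \<open>d\<close> vanishes almost everywhere, that is, almost all sections equal one set \<open>E\<close>
  up to null sets (\<open>invariant_sections_ae_constant\<close>). Then \<open>E\<close> is invariant up to null sets and
  therefore has measure 0 or 1, and so does \<open>D\<close>, a contradiction. The isometric factor
  defined by \<open>d\<close> takes the place of the eigenfunctions in the usual spectral argument.
\<close>

section \<open>Measure-preserving maps of probability spaces\<close>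

text \<open>Weak mixing is a property of the square of a system, so facts about a single system are stated
  in a locale that is closed under products.\<close>

locale measure_preserving = prob_space M for M :: "'a measure" +
  fixes T :: "'a \<Rightarrow> 'a"
  assumes measurable_T[measurable]: "T \<in> measurable M M"
    and preserves: "B \<in> sets M \<Longrightarrow> measure M (T -` B \<inter> space M) = measure M B"

lemma mds_imp_measure_preserving: "mds M T \<Longrightarrow> measure_preserving M T"
  by (simp add: mds_def mds_axioms_def lebesgue_prob_space_def measure_preserving_def
      measure_preserving_axioms_def)

lemma preimage_pow_Int:
  "preimage_pow M T n (A \<inter> B) = preimage_pow M T n A \<inter> preimage_pow M T n B"
  by (auto simp: preimage_pow_def)

lemma preimage_pow_INT:
  "J \<noteq> {} \<Longrightarrow> preimage_pow M T n (\<Inter>j\<in>J. A j) = (\<Inter>j\<in>J. preimage_pow M T n (A j))"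
  by (auto simp: preimage_pow_def)

lemma preimage_pow_sym_diff:
  "preimage_pow M T n (sym_diff A B) = sym_diff (preimage_pow M T n A) (preimage_pow M T n B)"
  by (auto simp: preimage_pow_def)

lemma (in finite_measure) measure_sym_diff_triangle:
  assumes [measurable]: "A \<in> sets M" "B \<in> sets M" "C \<in> sets M"
  shows "measure M (sym_diff A C) \<le> measure M (sym_diff A B) + measure M (sym_diff B C)"
proof -
  have "measure M (sym_diff A C) \<le> measure M (sym_diff A B \<union> sym_diff B C)"
    by (intro finite_measure_mono) auto
  also have "\<dots> \<le> measure M (sym_diff A B) + measure M (sym_diff B C)"
    by (intro measure_Un_le) auto
  finally show ?thesis .
qed

lemma IndD:
  assumes "F \<in> Ind M T k A" "J \<subseteq> F" "finite J" "J \<noteq> {}" "s \<in> J \<rightarrow> {1..k}"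
  shows "measure M (\<Inter>j\<in>J. preimage_pow M T j (A (s j))) > 0"
  using assms by (simp add: Ind_def)

lemma hitting_times_witness:
  assumes "n \<in> hitting_times M T A B"
  obtains x where "x \<in> A" "x \<in> preimage_pow M T n B"
proof -
  have "A \<inter> preimage_pow M T n B \<noteq> {}"
    using assms by (auto simp: hitting_times_def)
  then show thesis using that by blast
qed

context measure_preserving
begin

lemma measurable_pow[measurable]: "T ^^ n \<in> measurable M M"
  by (rule measurable_compose_n[OF measurable_T])

lemma pow_in_space: "x \<in> space M \<Longrightarrow> (T ^^ n) x \<in> space M"
  by (rule measurable_space[OF measurable_pow])

lemma preimage_pow_sets[measurable]: "B \<in> sets M \<Longrightarrow> preimage_pow M T n B \<in> sets M"
  unfolding preimage_pow_def by measurable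

lemma preimage_pow_add: "preimage_pow M T m (preimage_pow M T n B) = preimage_pow M T (m + n) B"
proof -
  have "(T ^^ (m + n)) x = (T ^^ n) ((T ^^ m) x)" for x
    by (metis add.commute comp_apply funpow_add)
  then show ?thesis
    using pow_in_space by (auto simp: preimage_pow_def)
qed

lemma preimage_pow_0: "B \<subseteq> space M \<Longrightarrow> preimage_pow M T 0 B = B"
  by (auto simp: preimage_pow_def)

lemma measure_preimage_pow:
  "B \<in> sets M \<Longrightarrow> measure M (preimage_pow M T n B) = measure M B"
proof (induction n)
  case 0
  then show ?case by (simp add: preimage_pow_0 sets.sets_into_space)
next
  case (Suc n)
  have "preimage_pow M T (Suc n) B = T -` preimage_pow M T n B \<inter> space M"
    using preimage_pow_add[of 1 n B] by (simp add: preimage_pow_def)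
  then show ?case
    using Suc preserves[of "preimage_pow M T n B"] by simp
qed

lemma distr_pow: "distr M M (T ^^ n) = M"
proof (rule measure_eqI)
  fix B assume "B \<in> sets (distr M M (T ^^ n))"
  then have "B \<in> sets M" by simp
  then show "emeasure (distr M M (T ^^ n)) B = emeasure M B"
    using measure_preimage_pow[of B n]
    by (simp add: emeasure_distr emeasure_eq_measure preimage_pow_def)
qed simp

lemma AE_pow: "AE x in M. P x \<Longrightarrow> AE x in M. P ((T ^^ n) x)"
  using AE_distrD[OF measurable_pow, where P = P] unfolding distr_pow .

lemma measure_preserving_prod: "measure_preserving (M \<Otimes>\<^sub>M M) (map_prod T T)"
proof -
  interpret MM: pair_prob_space M M ..
  have T1: "distr M M T = M" using distr_pow[of 1] by simp
  have distr: "distr (M \<Otimes>\<^sub>M M) (M \<Otimes>\<^sub>M M) (map_prod T T) = M \<Otimes>\<^sub>M M"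
    using pair_measure_distr[of T M M T M M] sigma_finite_measure_axioms
    by (simp add: T1 map_prod_def)
  have meas: "map_prod T T \<in> measurable (M \<Otimes>\<^sub>M M) (M \<Otimes>\<^sub>M M)"
    unfolding map_prod_def by measurable
  show ?thesis
  proof (intro measure_preserving.intro measure_preserving_axioms.intro)
    show "prob_space (M \<Otimes>\<^sub>M M)" by (rule MM.prob_space_axioms)
    show "map_prod T T \<in> measurable (M \<Otimes>\<^sub>M M) (M \<Otimes>\<^sub>M M)" by (rule meas)
    show "measure (M \<Otimes>\<^sub>M M) (map_prod T T -` B \<inter> space (M \<Otimes>\<^sub>M M)) = measure (M \<Otimes>\<^sub>M M) B"
      if "B \<in> sets (M \<Otimes>\<^sub>M M)" for B
      using measure_distr[OF meas that] unfolding distr ..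
  qed
qed

lemma measure_preimage_pow_Int_shift:
  assumes [measurable]: "A \<in> sets M" "B \<in> sets M"
  shows "measure M (preimage_pow M T m A \<inter> preimage_pow M T (m + n) B)
    = measure M (A \<inter> preimage_pow M T n B)"
proof -
  have "preimage_pow M T m A \<inter> preimage_pow M T (m + n) B = preimage_pow M T m (A \<inter> preimage_pow M T n B)"
    by (simp add: preimage_pow_Int preimage_pow_add)
  then show ?thesis by (simp add: measure_preimage_pow)
qed

text \<open>The set of points that visit \<^term>\<open>B\<close> infinitely often is strictly invariant. It has the same
  measure as the set of points that ever visit \<^term>\<open>B\<close>, because the sets of points with a visit
  after time \<open>m\<close> decrease in \<open>m\<close> and are preimages of each other. So it has at least the measure
  of \<^term>\<open>B\<close>, and it misses \<^term>\<open>A\<close> up to a null set.\<close>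

lemma invariant_set_if_never_hits:
  assumes [measurable]: "A \<in> sets M" "B \<in> sets M"
    and pos: "measure M A > 0" "measure M B > 0"
    and never: "hitting_times M T A B = {}"
  obtains D where "D \<in> sets M" "\<And>x. x \<in> space M \<Longrightarrow> T x \<in> D \<longleftrightarrow> x \<in> D"
    "measure M D > 0" "measure M D < 1"
proof -
  define U where "U m = (\<Union>n\<in>{m..}. preimage_pow M T n B)" for m
  have [measurable]: "U m \<in> sets M" for m unfolding U_def by measurable
  have U_step: "T x \<in> U m \<longleftrightarrow> x \<in> U (Suc m)" if "x \<in> space M" for x m
  proof -
    have "x \<in> preimage_pow M T (Suc n) B \<longleftrightarrow> T x \<in> preimage_pow M T n B" for n
      using that preimage_pow_add[of 1 n B] by (auto simp: preimage_pow_def measurable_space[OF measurable_T]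
          funpow_Suc_right simp del: funpow.simps)
    moreover have "(\<exists>n\<ge>Suc m. Q n) \<longleftrightarrow> (\<exists>n\<ge>m. Q (Suc n))" for Q
      by (metis Suc_le_D Suc_le_mono)
    ultimately show ?thesis
      unfolding U_def by (simp add: Bex_def)
  qed
  have "(\<lambda>m. measure M (U m)) = (\<lambda>m. measure M (U 0))"
  proof
    fix m
    show "measure M (U m) = measure M (U 0)"
    proof (induction m)
      case (Suc m)
      have "U (Suc m) = T -` U m \<inter> space M"
        using U_step sets.sets_into_space[of "U (Suc m)" M] by auto
      then show ?case using Suc preserves[of "U m"] by simp
    qed simp
  qed
  moreover have "decseq U"
    unfolding U_def decseq_def by (intro allI impI UN_mono) auto
  then have "(\<lambda>m. measure M (U m)) \<longlonglongrightarrow> measure M (\<Inter>m. U m)"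
    by (intro finite_Lim_measure_decseq) auto
  ultimately have eq: "measure M (\<Inter>m. U m) = measure M (U 0)"
    by (simp add: LIMSEQ_const_iff)
  have "measure M B \<le> measure M (U 0)"
    using preimage_pow_0[of B] sets.sets_into_space[of B M]
    by (intro finite_measure_mono) (auto simp: U_def intro!: exI[of _ 0])
  moreover have "measure M (A \<inter> (\<Inter>m. U m)) = 0"
  proof -
    have "A \<inter> preimage_pow M T n B \<in> null_sets M" for n
    proof -
      have "n \<notin> hitting_times M T A B" using never by simp
      then show ?thesis
        by (auto simp: hitting_times_def null_sets_def emeasure_eq_measure zero_less_measure_iff)
    qed
    then have "(\<Union>n. A \<inter> preimage_pow M T n B) \<in> null_sets M" by blast
    then have "A \<inter> (\<Inter>m. U m) \<in> null_sets M"
      by (rule null_sets_subset) (auto simp: U_def)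
    then show ?thesis by (simp add: measure_eq_0_null_sets)
  qed
  moreover have "measure M A + measure M (\<Inter>m. U m) = measure M (A \<union> (\<Inter>m. U m)) + measure M (A \<inter> (\<Inter>m. U m))"
    by (subst measure_Un3) (auto simp: fmeasurable_eq_sets)
  moreover have "measure M (A \<union> (\<Inter>m. U m)) \<le> 1" by simp
  ultimately have "measure M (\<Inter>m. U m) > 0" "measure M (\<Inter>m. U m) < 1"
    using pos eq by linarith+
  moreover have "T x \<in> (\<Inter>m. U m) \<longleftrightarrow> x \<in> (\<Inter>m. U m)" if "x \<in> space M" for x
  proof -
    have "x \<in> U m" if "x \<in> U (Suc m)" for m
      using that \<open>decseq U\<close> by (auto simp: decseq_Suc_iff)
    then show ?thesis using U_step[OF that] by auto
  qed
  ultimately show thesis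
    by (intro that[of "\<Inter>m. U m"]) auto
qed

end

section \<open>Sections of measurable sets in a product\<close>

lemma (in prob_space) AE_witness:
  assumes "AE x in M. P x"
  obtains x where "x \<in> space M" "P x"
proof -
  from assms obtain S where S: "S \<subseteq> {x \<in> space M. P x}" "prob S = 1"
    by (rule AE_E_prob)
  then have "S \<noteq> {}" by auto
  then show thesis using S(1) that by blast
qed

text \<open>Induction over the product \<open>\<sigma>\<close>-algebra. Rectangles have at most two different sections. For a
  countable union, a section is first approximated by the finite partial unions, and the members of
  a finite union by elements of the given dense sets; so the finite unions of these elements are
  dense, and there are only countably many of them.\<close>

lemma (in prob_space) countable_dense_sections:
  assumes "D \<in> sets (N \<Otimes>\<^sub>M M)"
  shows "\<exists>Q. countable Q \<and> Q \<subseteq> sets M \<and>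
    (\<forall>x\<in>space N. \<forall>\<epsilon>>0. \<exists>q\<in>Q. measure M (sym_diff (Pair x -` D) q) < \<epsilon>)"
  using assms unfolding sets_pair_measure
proof (induction D rule: sigma_sets.induct)
  case (Basic D)
  then obtain A B where D: "D = A \<times> B" "A \<in> sets N" "B \<in> sets M" by auto
  have "\<exists>q\<in>{B, {}}. measure M (sym_diff (Pair x -` D) q) < \<epsilon>" if "\<epsilon> > 0" for x and \<epsilon> :: real
  proof (cases "x \<in> A")
    case True
    then have "Pair x -` D = B" by (auto simp: D)
    with that show ?thesis by simp
  next
    case False
    then have "Pair x -` D = {}" by (auto simp: D)
    with that show ?thesis by simp
  qed
  with D(3) show ?case by (intro exI[of _ "{B, {}}"]) blast
next
  case Empty
  show ?case by (intro exI[of _ "{{}}"]) auto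
next
  case (Compl D)
  then obtain Q where Q: "countable Q" "Q \<subseteq> sets M"
    "\<And>x \<epsilon>. x \<in> space N \<Longrightarrow> \<epsilon> > 0 \<Longrightarrow> \<exists>q\<in>Q. measure M (sym_diff (Pair x -` D) q) < \<epsilon>"
    by blast
  have D: "D \<subseteq> space N \<times> space M"
    using Compl(1) sets.sets_into_space[of D "N \<Otimes>\<^sub>M M"]
    by (simp add: sets_pair_measure space_pair_measure)
  have "\<exists>q\<in>(\<lambda>q. space M - q) ` Q. measure M (sym_diff (Pair x -` (space N \<times> space M - D)) q) < \<epsilon>"
    if x: "x \<in> space N" and \<epsilon>: "\<epsilon> > 0" for x and \<epsilon> :: real
  proof -
    obtain q where q: "q \<in> Q" "measure M (sym_diff (Pair x -` D) q) < \<epsilon>"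
      using Q(3)[OF x \<epsilon>] by blast
    have "q \<subseteq> space M" using q(1) Q(2) sets.sets_into_space by blast
    then have "sym_diff (Pair x -` (space N \<times> space M - D)) (space M - q) = sym_diff (Pair x -` D) q"
      using D x by auto
    with q show ?thesis by (metis imageI)
  qed
  with Q show ?case
    by (intro exI[of _ "(\<lambda>q. space M - q) ` Q"]) auto
next
  case (Union D)
  then obtain Q where Q: "\<And>i. countable (Q i)" "\<And>i. Q i \<subseteq> sets M"
    "\<And>i x \<epsilon>. x \<in> space N \<Longrightarrow> \<epsilon> > 0 \<Longrightarrow> \<exists>q\<in>Q i. measure M (sym_diff (Pair x -` D i) q) < \<epsilon>"
    by metis
  have Dm: "D i \<in> sets (N \<Otimes>\<^sub>M M)" for i
    using Union(1) by (simp add: sets_pair_measure)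
  have Qm: "q \<in> sets M" if "q \<in> Q i" for q i
    using Q(2) that by blast
  define R where "R = Union ` {F. finite F \<and> F \<subseteq> (\<Union>i. Q i)}"
  have "countable R"
    unfolding R_def using Q(1) by (intro countable_image countable_Collect_finite_subset) auto
  moreover have "R \<subseteq> sets M"
  proof -
    have "(\<Union>i. Q i) \<subseteq> sets M" using Q(2) by blast
    then show ?thesis unfolding R_def by (auto intro!: sets.finite_Union)
  qed
  moreover have "\<exists>q\<in>R. measure M (sym_diff (Pair x -` (\<Union>i. D i)) q) < \<epsilon>"
    if x: "x \<in> space N" and \<epsilon>: "\<epsilon> > 0" for x and \<epsilon> :: real
  proof -
    define S where "S i = Pair x -` D i" for i
    have Sm[measurable]: "S i \<in> sets M" for i unfolding S_def by (rule sets_Pair1[OF Dm])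
    define V where "V n = (\<Union>i<n. S i)" for n
    have Vm[measurable]: "V n \<in> sets M" for n unfolding V_def by measurable
    have "incseq V" unfolding V_def incseq_def by (intro allI impI UN_mono) auto
    moreover have "(\<Union>n. V n) = (\<Union>i. S i)" unfolding V_def by blast
    ultimately have "(\<lambda>n. measure M (V n)) \<longlonglongrightarrow> measure M (\<Union>i. S i)"
      using finite_Lim_measure_incseq[of V] Vm by (metis image_subsetI)
    then have "\<forall>\<^sub>F n in sequentially. measure M (\<Union>i. S i) - \<epsilon> / 2 < measure M (V n)"
      by (rule order_tendstoD) (use \<epsilon> in simp)
    then obtain n where "measure M (\<Union>i. S i) - \<epsilon> / 2 < measure M (V n)"
      using eventually_happens'[OF sequentially_bot] by blast
    moreover have "measure M ((\<Union>i. S i) - V n) = measure M (\<Union>i. S i) - measure M (V n)"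
      by (intro finite_measure_Diff) (auto simp: V_def)
    ultimately have tail: "measure M ((\<Union>i. S i) - V n) < \<epsilon> / 2" by linarith
    \<comment> \<open>the errors of the first \<open>n\<close> members add up to at most \<open>\<epsilon> / 2\<close>; the \<open>+ 1\<close> covers \<open>n = 0\<close>\<close>
    have "\<forall>i. \<exists>q\<in>Q i. measure M (sym_diff (S i) q) < \<epsilon> / (2 * (real n + 1))"
      unfolding S_def using Q(3)[OF x] \<epsilon> by simp
    then obtain q where q: "\<And>i. q i \<in> Q i"
      "\<And>i. measure M (sym_diff (S i) (q i)) < \<epsilon> / (2 * (real n + 1))"
      by metis
    have [measurable]: "q i \<in> sets M" for i using q(1) Qm by blast
    have "measure M (sym_diff (\<Union>i. S i) (\<Union>i<n. q i))
        \<le> measure M (((\<Union>i. S i) - V n) \<union> (\<Union>i<n. sym_diff (S i) (q i)))"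
      by (intro finite_measure_mono) (auto simp: V_def)
    also have "\<dots> \<le> measure M ((\<Union>i. S i) - V n) + measure M (\<Union>i<n. sym_diff (S i) (q i))"
      by (intro measure_Un_le) auto
    also have "measure M (\<Union>i<n. sym_diff (S i) (q i)) \<le> (\<Sum>i<n. measure M (sym_diff (S i) (q i)))"
      by (intro measure_UNION_le) auto
    also have "\<dots> \<le> (\<Sum>i<n. \<epsilon> / (2 * (real n + 1)))"
      by (intro sum_mono less_imp_le q(2))
    also have "\<dots> \<le> \<epsilon> / 2"
      using \<epsilon> by (simp add: field_simps)
    finally have "measure M (sym_diff (\<Union>i. S i) (\<Union>i<n. q i)) < \<epsilon>"
      using tail by simp
    moreover have "(\<Union>i<n. q i) \<in> R"
      unfolding R_def using q(1) by blast
    moreover have "Pair x -` (\<Union>i. D i) = (\<Union>i. S i)"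
      unfolding S_def by blast
    ultimately show ?thesis by metis
  qed
  ultimately show ?case by blast
qed

section \<open>Simultaneous hitting times give weak mixing\<close>

context measure_preserving
begin

text \<open>This identity makes \<^term>\<open>T\<close> an isometry for the distance \<open>\<mu>(D\<^sub>x \<triangle> D\<^sub>y)\<close>.\<close>

lemma preimage_pow_section:
  assumes D[measurable]: "D \<in> sets (M \<Otimes>\<^sub>M M)"
    and inv: "\<And>x y. x \<in> space M \<Longrightarrow> y \<in> space M \<Longrightarrow> (T x, T y) \<in> D \<longleftrightarrow> (x, y) \<in> D"
    and x: "x \<in> space M"
  shows "preimage_pow M T n (Pair ((T ^^ n) x) -` D) = Pair x -` D"
proof -
  have "((T ^^ n) x, (T ^^ n) y) \<in> D \<longleftrightarrow> (x, y) \<in> D" if "y \<in> space M" for y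
    by (induction n) (use x that inv pow_in_space in auto)
  moreover have "Pair x -` D \<subseteq> space M"
    using sets.sets_into_space[OF sets_Pair1[OF D]] .
  ultimately show ?thesis by (auto simp: preimage_pow_def)
qed

text \<open>The map \<^term>\<open>T\<close> is an isometry for the distance between sections. Two pieces \<open>A\<close> and \<open>B\<close> of
  positive measure and small diameter cannot be far apart: at a common time some \<open>x \<in> A\<close> is back in
  \<open>A\<close> and some \<open>y \<in> A\<close> is in \<open>B\<close>, while the images of \<open>x\<close> and \<open>y\<close> are as close as \<open>x\<close> and \<open>y\<close> are.
  By separability the pieces of positive measure cover almost everything at every scale.\<close>

lemma invariant_sections_ae_constant:
  assumes D[measurable]: "D \<in> sets (M \<Otimes>\<^sub>M M)"
    and inv: "\<And>x y. x \<in> space M \<Longrightarrow> y \<in> space M \<Longrightarrow> (T x, T y) \<in> D \<longleftrightarrow> (x, y) \<in> D"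
    and hits: "\<And>A B. A \<in> sets M \<Longrightarrow> B \<in> sets M \<Longrightarrow> measure M A > 0 \<Longrightarrow> measure M B > 0 \<Longrightarrow>
      hitting_times M T A A \<inter> hitting_times M T A B \<noteq> {}"
  obtains E where "E \<in> sets M" "AE x in M. measure M (sym_diff (Pair x -` D) E) = 0"
proof -
  have Dx[measurable]: "Pair x -` D \<in> sets M" for x by (rule sets_Pair1[OF D])
  define d where "d x y = measure M (sym_diff (Pair x -` D) (Pair y -` D))" for x y
  have d_triangle: "d x z \<le> d x y + d y z" for x y z
    unfolding d_def by (rule measure_sym_diff_triangle) measurable
  have d_sym: "d x y = d y x" for x y
    unfolding d_def by (simp add: Un_commute)
  have d_pow: "d ((T ^^ n) x) ((T ^^ n) y) = d x y" if "x \<in> space M" "y \<in> space M" for x y n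
    using measure_preimage_pow[of "sym_diff (Pair ((T ^^ n) x) -` D) (Pair ((T ^^ n) y) -` D)" n]
    unfolding d_def preimage_pow_sym_diff
    by (simp add: preimage_pow_section[OF D inv] that)
  obtain Q where Q: "countable Q" "Q \<subseteq> sets M"
    "\<And>x \<epsilon>. x \<in> space M \<Longrightarrow> \<epsilon> > 0 \<Longrightarrow> \<exists>q\<in>Q. measure M (sym_diff (Pair x -` D) q) < \<epsilon>"
    using countable_dense_sections[OF D] by blast
  \<comment> \<open>the balls around the points of the countable dense set are the small pieces\<close>
  define C where "C q \<epsilon> = {x \<in> space M. measure M (sym_diff (Pair x -` D) q) < \<epsilon>}"
    for q and \<epsilon> :: real
  have C_sets: "C q \<epsilon> \<in> sets M" if [measurable]: "q \<in> sets M" for q \<epsilon>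
  proof -
    have "(\<lambda>x. measure M (Pair x -` sym_diff D (space M \<times> q))) \<in> borel_measurable M"
      unfolding measure_def by (intro borel_measurable_enn2real measurable_emeasure_Pair) measurable
    moreover have "C q \<epsilon> = {x \<in> space M. measure M (Pair x -` sym_diff D (space M \<times> q)) < \<epsilon>}"
      unfolding C_def by (intro Collect_cong conj_cong refl arg_cong2[where f = "(<)"]
          arg_cong[where f = "measure M"]) auto
    ultimately show ?thesis by simp
  qed
  have C_diam: "d x y < 2 * \<epsilon>" if q: "q \<in> Q" and "x \<in> C q \<epsilon>" "y \<in> C q \<epsilon>" for q x y \<epsilon>
  proof -
    have "q \<in> sets M" using q Q(2) by blast
    then have "d x y \<le> measure M (sym_diff (Pair x -` D) q) + measure M (sym_diff q (Pair y -` D))"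
      unfolding d_def by (intro measure_sym_diff_triangle) auto
    also have "sym_diff q (Pair y -` D) = sym_diff (Pair y -` D) q" by blast
    finally show ?thesis using that by (simp add: C_def)
  qed
  \<comment> \<open>three steps of length \<open>2 * \<epsilon>\<close>: inside the first piece, along the orbit, inside the second piece\<close>
  have near: "d a b < 6 * \<epsilon>"
    if a: "a \<in> C q \<epsilon>" "q \<in> Q" "measure M (C q \<epsilon>) > 0"
      and b: "b \<in> C r \<epsilon>" "r \<in> Q" "measure M (C r \<epsilon>) > 0" for a b q r \<epsilon>
  proof -
    have Cm[measurable]: "C q \<epsilon> \<in> sets M" "C r \<epsilon> \<in> sets M"
      using C_sets Q(2) a b by blast+
    obtain n where n: "n \<in> hitting_times M T (C q \<epsilon>) (C q \<epsilon>)" "n \<in> hitting_times M T (C q \<epsilon>) (C r \<epsilon>)"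
      using hits[OF Cm a(3) b(3)] by blast
    then obtain x y where x: "x \<in> C q \<epsilon>" "x \<in> preimage_pow M T n (C q \<epsilon>)"
      and y: "y \<in> C q \<epsilon>" "y \<in> preimage_pow M T n (C r \<epsilon>)"
      by (meson hitting_times_witness)
    have sp: "x \<in> space M" "y \<in> space M" using x y by (auto simp: C_def)
    have "d a b \<le> d a ((T ^^ n) x) + d ((T ^^ n) x) ((T ^^ n) y) + d ((T ^^ n) y) b"
      using d_triangle[of a b "(T ^^ n) x"] d_triangle[of "(T ^^ n) x" b "(T ^^ n) y"] by simp
    moreover have "d a ((T ^^ n) x) < 2 * \<epsilon>"
      using C_diam[OF a(2,1)] x by (simp add: preimage_pow_def)
    moreover have "d ((T ^^ n) x) ((T ^^ n) y) < 2 * \<epsilon>"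
      using C_diam[OF a(2) x(1) y(1)] d_pow[OF sp] by simp
    moreover have "d ((T ^^ n) y) b < 2 * \<epsilon>"
      using C_diam[OF b(2) _ b(1)] y by (simp add: preimage_pow_def)
    ultimately show ?thesis by simp
  qed
  define good where "good x \<longleftrightarrow> (\<forall>q\<in>Q. \<forall>k::nat. x \<in> C q (1 / (real k + 1)) \<longrightarrow>
      measure M (C q (1 / (real k + 1))) > 0)" for x
  have "AE x in M. x \<in> C q (1 / (real k + 1)) \<longrightarrow> measure M (C q (1 / (real k + 1))) > 0"
    if "q \<in> Q" for q k
  proof (cases "measure M (C q (1 / (real k + 1))) > 0")
    case False
    then have "C q (1 / (real k + 1)) \<in> null_sets M"
      using C_sets[of q "1 / (real k + 1)"] that Q(2)
      by (auto simp: null_sets_def emeasure_eq_measure zero_less_measure_iff)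
    from AE_not_in[OF this] show ?thesis by eventually_elim simp
  qed simp
  then have good_AE: "AE x in M. good x"
    unfolding good_def using Q(1) by (subst AE_ball_countable) (auto simp: AE_all_countable)
  have good_dist: "d a b = 0" if "good a" "good b" and sp: "a \<in> space M" "b \<in> space M" for a b
  proof -
    have "d a b \<le> 6 * (1 / (real k + 1))" for k
    proof -
      obtain q where q: "q \<in> Q" "a \<in> C q (1 / (real k + 1))"
        using Q(3)[OF sp(1), of "1 / (real k + 1)"] sp by (auto simp: C_def)
      obtain r where r: "r \<in> Q" "b \<in> C r (1 / (real k + 1))"
        using Q(3)[OF sp(2), of "1 / (real k + 1)"] sp by (auto simp: C_def)
      show ?thesis
        using near[OF q(2,1) _ r(2,1)] q r that by (auto simp: good_def less_imp_le)
    qed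
    moreover have "(\<lambda>k. 6 * (1 / (real k + 1))) \<longlonglongrightarrow> 6 * 0"
      using LIMSEQ_inverse_real_of_nat
      by (intro tendsto_mult tendsto_const) (simp add: inverse_eq_divide add.commute)
    ultimately have "d a b \<le> 0"
      by (intro LIMSEQ_le_const[of _ 0]) auto
    then show ?thesis by (simp add: d_def measure_le_0_iff)
  qed
  obtain a where a: "a \<in> space M" "good a"
    using good_AE by (rule AE_witness)
  have "AE x in M. d x a = 0"
    using good_AE AE_space by eventually_elim (use good_dist a in blast)
  then show thesis
    using that[OF Dx[of a]] by (simp add: d_def)
qed

lemma weakly_mixing_if_simultaneous_hits:
  assumes hits: "\<And>A B. A \<in> sets M \<Longrightarrow> B \<in> sets M \<Longrightarrow> measure M A > 0 \<Longrightarrow> measure M B > 0 \<Longrightarrow>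
      hitting_times M T A A \<inter> hitting_times M T A B \<noteq> {}"
  shows "weakly_mixing M T"
proof (rule ccontr)
  assume "\<not> weakly_mixing M T"
  then obtain A B where AB: "A \<in> sets (M \<Otimes>\<^sub>M M)" "B \<in> sets (M \<Otimes>\<^sub>M M)"
    "measure (M \<Otimes>\<^sub>M M) A > 0" "measure (M \<Otimes>\<^sub>M M) B > 0"
    "hitting_times (M \<Otimes>\<^sub>M M) (map_prod T T) A B = {}"
    unfolding weakly_mixing_def ergodic_def by blast
  interpret MM: measure_preserving "M \<Otimes>\<^sub>M M" "map_prod T T"
    by (rule measure_preserving_prod)
  obtain D where D[measurable]: "D \<in> sets (M \<Otimes>\<^sub>M M)"
    and inv: "\<And>z. z \<in> space (M \<Otimes>\<^sub>M M) \<Longrightarrow> map_prod T T z \<in> D \<longleftrightarrow> z \<in> D"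
    and D01: "measure (M \<Otimes>\<^sub>M M) D > 0" "measure (M \<Otimes>\<^sub>M M) D < 1"
    using MM.invariant_set_if_never_hits[OF AB] by blast
  have inv': "(T x, T y) \<in> D \<longleftrightarrow> (x, y) \<in> D" if "x \<in> space M" "y \<in> space M" for x y
    using inv[of "(x, y)"] that by (simp add: space_pair_measure)
  obtain E where E[measurable]: "E \<in> sets M"
    and const: "AE x in M. measure M (sym_diff (Pair x -` D) E) = 0"
    using invariant_sections_ae_constant[OF D inv' hits] by blast
  have Dx[measurable]: "Pair x -` D \<in> sets M" for x by (rule sets_Pair1[OF D])
  \<comment> \<open>compare the sections at a typical point and at its image, both of which agree with \<open>E\<close>\<close>
  have E_inv: "measure M (sym_diff E (preimage_pow M T n E)) = 0" for n
  proof -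
    have "AE x in M. measure M (sym_diff (Pair x -` D) E) = 0 \<and>
        measure M (sym_diff (Pair ((T ^^ n) x) -` D) E) = 0"
      using const AE_pow[OF const, of n] by eventually_elim simp
    then obtain x where x: "x \<in> space M" "measure M (sym_diff (Pair x -` D) E) = 0"
      "measure M (sym_diff (Pair ((T ^^ n) x) -` D) E) = 0"
      by (rule AE_witness) blast
    have "measure M (sym_diff (Pair x -` D) (preimage_pow M T n E)) = 0"
      using x(3) measure_preimage_pow[of "sym_diff (Pair ((T ^^ n) x) -` D) E" n]
      by (simp add: preimage_pow_sym_diff preimage_pow_section[OF D inv' x(1)])
    then show ?thesis
      using measure_sym_diff_triangle[of E "Pair x -` D" "preimage_pow M T n E"] x(2)
      by (simp add: Un_commute measure_le_0_iff)
  qed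
  have "measure M E = 0 \<or> measure M (space M - E) = 0"
  proof (rule ccontr)
    assume "\<not> ?thesis"
    then obtain n where "n \<in> hitting_times M T E (space M - E)"
      using hits[of E "space M - E"] by (auto simp: zero_less_measure_iff)
    then have "0 < measure M (E \<inter> preimage_pow M T n (space M - E))"
      by (simp add: hitting_times_def)
    also have "\<dots> \<le> measure M (sym_diff E (preimage_pow M T n E))"
      by (intro finite_measure_mono) (auto simp: preimage_pow_def)
    finally show False using E_inv by simp
  qed
  then have E01: "measure M E = 0 \<or> measure M E = 1"
    using prob_compl[OF E] by auto
  have "emeasure (M \<Otimes>\<^sub>M M) D = (\<integral>\<^sup>+x. emeasure M (Pair x -` D) \<partial>M)"
    by (rule emeasure_pair_measure_alt) (rule D)
  also have "\<dots> = (\<integral>\<^sup>+x. emeasure M E \<partial>M)"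
  proof (rule nn_integral_cong_AE)
    show "AE x in M. emeasure M (Pair x -` D) = emeasure M E"
      using const
    proof eventually_elim
      case (elim x)
      have "measure M (Pair x -` D) \<le> measure M (E \<union> sym_diff (Pair x -` D) E)"
        "measure M E \<le> measure M (Pair x -` D \<union> sym_diff (Pair x -` D) E)"
        by (intro finite_measure_mono; auto)+
      moreover have "measure M (E \<union> sym_diff (Pair x -` D) E) \<le> measure M E + measure M (sym_diff (Pair x -` D) E)"
        "measure M (Pair x -` D \<union> sym_diff (Pair x -` D) E)
          \<le> measure M (Pair x -` D) + measure M (sym_diff (Pair x -` D) E)"
        by (intro measure_Un_le; auto)+
      ultimately show ?case using elim by (simp add: emeasure_eq_measure)
    qed
  qed
  also have "\<dots> = emeasure M E" by (simp add: emeasure_space_1)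
  finally have "measure (M \<Otimes>\<^sub>M M) D = measure M E" by (simp add: measure_def)
  with D01 E01 show False by auto
qed

text \<open>For \<open>j < k\<close> in an independence set of \<open>(A, B)\<close>, the sets \<open>T\<^sup>-\<^sup>j A \<inter> T\<^sup>-\<^sup>k A\<close> and
  \<open>T\<^sup>-\<^sup>j A \<inter> T\<^sup>-\<^sup>k B\<close> are the preimages under \<open>T\<^sup>j\<close> of the sets that witness the hitting time
  \<open>k - j\<close>.\<close>

lemma hitting_times_Int_if_independent:
  assumes ind: "independent_of_order M T family_inf 2"
    and A: "A \<in> sets M" "measure M A > 0" and B: "B \<in> sets M" "measure M B > 0"
  shows "hitting_times M T A A \<inter> hitting_times M T A B \<noteq> {}"
proof -
  define C where "C i = (if i = 1 then A else B)" for i :: nat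
  have "\<forall>i\<in>{1..2}. C i \<in> sets M \<and> measure M (C i) > 0"
    using A B by (simp add: C_def)
  then obtain F where F: "F \<in> Ind M T 2 C" "infinite F"
    using ind unfolding independent_of_order_def family_inf_def by blast
  obtain j where j: "j \<in> F" using F(2) by fastforce
  obtain k where k: "k \<in> F" "j < k" using F(2) unfolding infinite_nat_iff_unbounded by blast
  have "k - j \<in> hitting_times M T A (C i)" if i: "i \<in> {1..2}" for i
  proof -
    define s where "s n = (if n = j then 1 else i)" for n
    have "measure M (\<Inter>n\<in>{j, k}. preimage_pow M T n (C (s n))) > 0"
      using i j k by (intro IndD[OF F(1)]) (auto simp: s_def)
    then have "measure M (preimage_pow M T j A \<inter> preimage_pow M T (j + (k - j)) (C i)) > 0"
      using k by (simp add: s_def C_def)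
    then show ?thesis
      using A B i measure_preimage_pow_Int_shift[of A "C i" j "k - j"]
      by (simp add: hitting_times_def C_def split: if_splits)
  qed
  from this[of 1] this[of 2] show ?thesis by (auto simp: C_def)
qed

section \<open>Weak mixing gives independence along IP-sets\<close>

lemma hitting_times_Int_if_weakly_mixing:
  assumes wm: "weakly_mixing M T"
    and [measurable]: "A1 \<in> sets M" "B1 \<in> sets M" "A2 \<in> sets M" "B2 \<in> sets M"
    and pos: "measure M A1 > 0" "measure M B1 > 0" "measure M A2 > 0" "measure M B2 > 0"
  shows "hitting_times M T A1 B1 \<inter> hitting_times M T A2 B2 \<noteq> {}"
proof -
  have prod: "measure (M \<Otimes>\<^sub>M M) (A \<times> B) = measure M A * measure M B" if "A \<in> sets M" "B \<in> sets M" for A B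
    using that by (simp add: measure_def emeasure_pair_measure_Times enn2real_mult)
  have "hitting_times (M \<Otimes>\<^sub>M M) (map_prod T T) (A1 \<times> A2) (B1 \<times> B2) \<noteq> {}"
    using wm pos unfolding weakly_mixing_def ergodic_def by (simp add: prod)
  then obtain n where "measure (M \<Otimes>\<^sub>M M) ((A1 \<times> A2) \<inter> preimage_pow (M \<Otimes>\<^sub>M M) (map_prod T T) n (B1 \<times> B2)) > 0"
    unfolding hitting_times_def by blast
  moreover have "(map_prod T T ^^ n) z = ((T ^^ n) (fst z), (T ^^ n) (snd z))" for z
    by (induction n) auto
  then have "(A1 \<times> A2) \<inter> preimage_pow (M \<Otimes>\<^sub>M M) (map_prod T T) n (B1 \<times> B2)
      = (A1 \<inter> preimage_pow M T n B1) \<times> (A2 \<inter> preimage_pow M T n B2)"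
    by (auto simp: preimage_pow_def space_pair_measure)
  ultimately show ?thesis
    by (auto simp: prod zero_less_mult_iff zero_less_measure_iff hitting_times_def)
qed

text \<open>Furstenberg's trick: with \<open>n\<close> a common element of \<open>N(A1, A2)\<close> and \<open>N(B1, B2)\<close>, take
  \<open>A = A1 \<inter> T\<^sup>-\<^sup>n A2\<close> and \<open>B = B1 \<inter> T\<^sup>-\<^sup>n B2\<close>. A visit from \<open>A\<close> to \<open>B\<close> is one from \<open>A1\<close> to \<open>B1\<close>, and
  after applying \<open>T\<^sup>n\<close> also one from \<open>A2\<close> to \<open>B2\<close>, as the powers of \<^term>\<open>T\<close> commute.\<close>

lemma hitting_times_filter_base:
  assumes wm: "weakly_mixing M T"
    and [measurable]: "A1 \<in> sets M" "B1 \<in> sets M" "A2 \<in> sets M" "B2 \<in> sets M"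
    and pos: "measure M A1 > 0" "measure M B1 > 0" "measure M A2 > 0" "measure M B2 > 0"
  obtains A B where "A \<in> sets M" "B \<in> sets M" "measure M A > 0" "measure M B > 0"
    "hitting_times M T A B \<subseteq> hitting_times M T A1 B1 \<inter> hitting_times M T A2 B2"
proof -
  obtain n where pos': "measure M (A1 \<inter> preimage_pow M T n A2) > 0" "measure M (B1 \<inter> preimage_pow M T n B2) > 0"
    using hitting_times_Int_if_weakly_mixing[OF wm, of A1 A2 B1 B2] pos by (auto simp: hitting_times_def)
  let ?A = "A1 \<inter> preimage_pow M T n A2" and ?B = "B1 \<inter> preimage_pow M T n B2"
  have "m \<in> hitting_times M T A1 B1 \<inter> hitting_times M T A2 B2" if "m \<in> hitting_times M T ?A ?B" for m
  proof -
    have pos_m: "measure M (?A \<inter> preimage_pow M T m ?B) > 0"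
      using that by (simp add: hitting_times_def)
    also have "measure M (?A \<inter> preimage_pow M T m ?B) \<le> measure M (A1 \<inter> preimage_pow M T m B1)"
      by (intro finite_measure_mono) (auto simp: preimage_pow_Int)
    finally have 1: "m \<in> hitting_times M T A1 B1" by (simp add: hitting_times_def)
    note pos_m
    also have "measure M (?A \<inter> preimage_pow M T m ?B)
        \<le> measure M (preimage_pow M T n A2 \<inter> preimage_pow M T (n + m) B2)"
      by (intro finite_measure_mono) (auto simp: preimage_pow_Int preimage_pow_add add.commute)
    also have "\<dots> = measure M (A2 \<inter> preimage_pow M T m B2)"
      by (rule measure_preimage_pow_Int_shift) auto
    finally have "m \<in> hitting_times M T A2 B2" by (simp add: hitting_times_def)
    with 1 show ?thesis by simp
  qed
  then show thesis
    using pos' by (intro that[of ?A ?B]) auto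
qed

lemma common_positive_hitting_time:
  assumes wm: "weakly_mixing M T" and "finite I"
    and "\<And>i. i \<in> I \<Longrightarrow> A i \<in> sets M" "\<And>i. i \<in> I \<Longrightarrow> B i \<in> sets M"
    and "\<And>i. i \<in> I \<Longrightarrow> measure M (A i) > 0" "\<And>i. i \<in> I \<Longrightarrow> measure M (B i) > 0"
  shows "\<exists>n\<ge>1. \<forall>i\<in>I. n \<in> hitting_times M T (A i) (B i)"
proof -
  have "\<exists>A' B'. A' \<in> sets M \<and> B' \<in> sets M \<and> measure M A' > 0 \<and> measure M B' > 0 \<and>
      (\<forall>i\<in>I. hitting_times M T A' B' \<subseteq> hitting_times M T (A i) (B i))"
    using assms(2-)
  proof (induction I)
    case empty
    show ?case by (intro exI[of _ "space M"]) (simp add: prob_space)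
  next
    case (insert i I)
    then obtain A' B' where AB': "A' \<in> sets M" "B' \<in> sets M" "measure M A' > 0" "measure M B' > 0"
      "\<forall>i\<in>I. hitting_times M T A' B' \<subseteq> hitting_times M T (A i) (B i)"
      by auto
    have i: "A i \<in> sets M" "B i \<in> sets M" "measure M (A i) > 0" "measure M (B i) > 0"
      using insert.prems by simp_all
    obtain A'' B'' where AB'': "A'' \<in> sets M" "B'' \<in> sets M" "measure M A'' > 0" "measure M B'' > 0"
      "hitting_times M T A'' B'' \<subseteq> hitting_times M T A' B' \<inter> hitting_times M T (A i) (B i)"
      by (rule hitting_times_filter_base[OF wm AB'(1,2) i(1,2) AB'(3,4) i(3,4)])
    show ?case
      by (intro exI[of _ A''] exI[of _ B''] conjI AB'' ballI) (use AB' AB'' in blast)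
  qed
  then obtain A' B' where [measurable]: "A' \<in> sets M" "B' \<in> sets M"
    and pos: "measure M A' > 0" "measure M B' > 0"
    and sub: "\<forall>i\<in>I. hitting_times M T A' B' \<subseteq> hitting_times M T (A i) (B i)"
    by blast
  \<comment> \<open>passing to \<open>T\<^sup>-\<^sup>1 B'\<close> excludes the hitting time 0\<close>
  have "hitting_times M T A' (preimage_pow M T 1 B') \<noteq> {}"
    using hitting_times_Int_if_weakly_mixing[OF wm, of A' "preimage_pow M T 1 B'" A' "preimage_pow M T 1 B'"] pos
    by (simp add: measure_preimage_pow)
  then obtain m where "m + 1 \<in> hitting_times M T A' B'"
    by (auto simp: hitting_times_def preimage_pow_add)
  with sub show ?thesis by (intro exI[of _ "m + 1"]) auto
qed

text \<open>Take \<open>a\<close> to be a hitting time for all pairs of cylinders over \<^term>\<open>F\<close>. A choice of indices on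
  \<open>F \<union> (a + F)\<close> restricts to one on \<open>F\<close> and, by translation, to another on \<open>F\<close>; a visit after time
  \<open>a\<close> from the first cylinder to the second realises both. An overlap of \<open>F\<close> and \<open>a + F\<close> does no
  harm, since the two restrictions come from one choice.\<close>

lemma Ind_extend:
  assumes wm: "weakly_mixing M T" and "k \<ge> 1"
    and A: "\<And>i. i \<in> {1..k} \<Longrightarrow> A i \<in> sets M"
    and F: "F \<in> Ind M T k A" "finite F" "F \<noteq> {}"
  shows "\<exists>a\<ge>1. F \<union> (+) a ` F \<in> Ind M T k A"
proof -
  define cyl where "cyl s = (\<Inter>j\<in>F. preimage_pow M T j (A (s j)))" for s
  have cyl_sets: "cyl s \<in> sets M" if "s \<in> F \<rightarrow>\<^sub>E {1..k}" for s
    unfolding cyl_def using that F A by (intro sets.finite_INT) (auto simp: PiE_iff)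
  have cyl_pos: "measure M (cyl s) > 0" if "s \<in> F \<rightarrow>\<^sub>E {1..k}" for s
    unfolding cyl_def using F that by (intro IndD) (auto simp: PiE_def)
  let ?W = "F \<rightarrow>\<^sub>E {1..k}"
  have "finite (?W \<times> ?W)" using F by (intro finite_cartesian_product finite_PiE) auto
  from common_positive_hitting_time[OF wm this, of "\<lambda>(s, t). cyl s" "\<lambda>(s, t). cyl t"]
  obtain a where a: "a \<ge> 1" "\<And>s t. s \<in> ?W \<Longrightarrow> t \<in> ?W \<Longrightarrow> a \<in> hitting_times M T (cyl s) (cyl t)"
    using cyl_sets cyl_pos by (auto simp: split_beta)
  have "measure M (\<Inter>j\<in>J. preimage_pow M T j (A (s j))) > 0"
    if J: "J \<subseteq> F \<union> (+) a ` F" "finite J" "J \<noteq> {}" and s: "s \<in> J \<rightarrow> {1..k}" for J s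
  proof -
    \<comment> \<open>extend the choice beyond \<open>J\<close> by the index 1, which exists because \<open>k \<ge> 1\<close>\<close>
    define s' where "s' j = (if j \<in> J then s j else 1)" for j
    have s': "s' j \<in> {1..k}" for j
      using s \<open>k \<ge> 1\<close> by (auto simp: s'_def)
    define u where "u = restrict s' F"
    define v where "v = restrict (\<lambda>j. s' (a + j)) F"
    have uv: "u \<in> ?W" "v \<in> ?W" using s' by (auto simp: u_def v_def)
    have "cyl u \<inter> preimage_pow M T a (cyl v) \<subseteq> (\<Inter>j\<in>J. preimage_pow M T j (A (s j)))"
    proof (intro subsetI INT_I)
      fix x j assume x: "x \<in> cyl u \<inter> preimage_pow M T a (cyl v)" and "j \<in> J"
      then have sj: "s j = s' j" by (simp add: s'_def)
      from J(1) \<open>j \<in> J\<close> consider "j \<in> F" | i where "i \<in> F" "j = a + i" by auto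
      then show "x \<in> preimage_pow M T j (A (s j))"
      proof cases
        case 1
        with x show ?thesis by (auto simp: sj cyl_def u_def)
      next
        case 2
        with x have "x \<in> preimage_pow M T j (A (s' j))"
          by (auto simp: cyl_def v_def preimage_pow_INT[OF F(3)] preimage_pow_add)
        then show ?thesis by (simp add: sj)
      qed
    qed
    moreover have "(\<Inter>j\<in>J. preimage_pow M T j (A (s j))) \<in> sets M"
      using J s A by (intro sets.finite_INT) (auto simp: Pi_iff)
    ultimately have "measure M (cyl u \<inter> preimage_pow M T a (cyl v))
        \<le> measure M (\<Inter>j\<in>J. preimage_pow M T j (A (s j)))"
      by (rule finite_measure_mono)
    then show ?thesis
      using a(2)[OF uv] by (simp add: hitting_times_def)
  qed
  then show ?thesis using a(1) unfolding Ind_def by blast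
qed

text \<open>Iterating the extension from \<open>{0}\<close>, the \<open>n\<close>-th stage contains all sums over subsets of the first
  \<open>n\<close> translations; the empty sum is the reason to keep 0 in every stage. A finite subset of the
  IP-set lies in one stage, so the IP-set is an independence set.\<close>

lemma weakly_mixing_imp_IP_independent:
  assumes wm: "weakly_mixing M T" and k: "k \<ge> 1"
  shows "independent_of_order M T family_ip k"
  unfolding independent_of_order_def
proof (intro allI impI)
  fix A assume A: "\<forall>i\<in>{1..k}. A i \<in> sets M \<and> measure M (A i) > 0"
  define P where "P F \<longleftrightarrow> F \<in> Ind M T k A \<and> finite F \<and> 0 \<in> F" for F
  have "P {0}"
    unfolding P_def Ind_def
  proof clarsimp
    fix J :: "nat set" and s assume "J \<subseteq> {0}" "J \<noteq> {}" and s: "s \<in> J \<rightarrow> {Suc 0..k}"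
    then have J: "J = {0}" by blast
    with s have "s 0 \<in> {1..k}" by auto
    with A have "A (s 0) \<in> sets M" "measure M (A (s 0)) > 0" by blast+
    with J show "measure M (\<Inter>j\<in>J. preimage_pow M T j (A (s j))) > 0"
      by (simp add: preimage_pow_0 sets.sets_into_space)
  qed
  moreover have "\<exists>F'. P F' \<and> (\<exists>a\<ge>1. F' = F \<union> (+) a ` F)" if "P F" for F
  proof -
    have "F \<in> Ind M T k A" "finite F" "F \<noteq> {}" using that by (auto simp: P_def)
    from Ind_extend[OF wm k _ this] A obtain a where "a \<ge> 1" "F \<union> (+) a ` F \<in> Ind M T k A"
      by auto
    with that show ?thesis unfolding P_def by blast
  qed
  ultimately obtain F where F: "\<And>n. P (F n)" "\<And>n. \<exists>a\<ge>1. F (Suc n) = F n \<union> (+) a ` F n"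
    using dependent_nat_choice[of "\<lambda>_. P" "\<lambda>_ F F'. \<exists>a\<ge>1. F' = F \<union> (+) a ` F"] by metis
  then obtain a where a: "\<And>n. a n \<ge> 1" "\<And>n. F (Suc n) = F n \<union> (+) (a n) ` F n" by metis
  have incF: "F m \<subseteq> F n" if "m \<le> n" for m n
    using lift_Suc_mono_le[of F, OF _ that] a(2) by simp
  have sums: "(\<Sum>i\<in>I. a i) \<in> F n" if "I \<subseteq> {..<n}" for I n
    using that
  proof (induction n arbitrary: I)
    case 0
    then show ?case using F(1)[of 0] by (simp add: P_def)
  next
    case (Suc n)
    have "I - {n} \<subseteq> {..<n}" using Suc.prems by (auto simp: less_Suc_eq)
    then have IH: "(\<Sum>i\<in>I - {n}. a i) \<in> F n" by (rule Suc.IH)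
    have "finite I" using Suc.prems finite_subset by blast
    show ?case
    proof (cases "n \<in> I")
      case True
      then have "(\<Sum>i\<in>I. a i) = a n + (\<Sum>i\<in>I - {n}. a i)"
        using \<open>finite I\<close> by (simp add: sum.remove)
      then show ?thesis using IH a(2) by simp
    next
      case False
      then show ?thesis using IH a(2) by simp
    qed
  qed
  define Q where "Q = {\<Sum>n\<in>I. a n | I. finite I \<and> I \<noteq> {}}"
  have "Q \<subseteq> (\<Union>n. F n)"
  proof
    fix q assume "q \<in> Q"
    then obtain I where I: "finite I" "q = (\<Sum>n\<in>I. a n)" unfolding Q_def by blast
    then obtain n where "I \<subseteq> {..<n}" using finite_nat_iff_bounded by blast
    with I sums show "q \<in> (\<Union>n. F n)" by blast
  qed
  have "Q \<in> Ind M T k A"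
    unfolding Ind_def
  proof (clarify)
    fix J s assume J: "J \<subseteq> Q" "finite J" "J \<noteq> {}" "s \<in> J \<rightarrow> {1..k}"
    have "J \<subseteq> (\<Union>n. F n)" using J(1) \<open>Q \<subseteq> (\<Union>n. F n)\<close> by blast
    then obtain n where "J \<subseteq> F n"
    proof -
      have "\<exists>n. J \<subseteq> F n" using J(2) \<open>J \<subseteq> (\<Union>n. F n)\<close>
      proof (induction J)
        case (insert j J)
        then obtain m n where "J \<subseteq> F m" "j \<in> F n" by auto
        then have "insert j J \<subseteq> F (max m n)" using incF[of m "max m n"] incF[of n "max m n"] by auto
        then show ?case ..
      qed simp
      then show thesis using that by blast
    qed
    then show "measure M (\<Inter>j\<in>J. preimage_pow M T j (A (s j))) > 0"
      using F(1)[of n] J(2-) unfolding P_def by (intro IndD) auto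
  qed
  moreover have "Q \<in> family_ip"
    unfolding family_ip_def is_IP_set_def Q_def using a(1) by blast
  ultimately show "Ind M T k A \<inter> family_ip \<noteq> {}" by blast
qed

end

section \<open>The equivalence\<close>

text \<open>An IP-set is unbounded because its generators are at least 1.\<close>

lemma family_ip_subset_family_inf: "family_ip \<subseteq> family_inf"
proof
  fix F assume "F \<in> family_ip"
  then obtain a :: "nat \<Rightarrow> nat" where a: "\<And>n. a n \<ge> 1"
    and sub: "{\<Sum>n\<in>I. a n | I. finite I \<and> I \<noteq> {}} \<subseteq> F"
    unfolding family_ip_def is_IP_set_def by blast
  have "\<exists>m\<ge>n. m \<in> F" for n
  proof -
    have "(\<Sum>i\<le>n. 1) \<le> (\<Sum>i\<le>n. a i)" by (intro sum_mono a)
    moreover have "(\<Sum>i\<le>n. a i) \<in> F" using sub by blast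
    ultimately show ?thesis by (intro exI[of _ "\<Sum>i\<le>n. a i"]) simp
  qed
  then show "F \<in> family_inf"
    unfolding family_inf_def by (simp add: infinite_nat_iff_unbounded_le)
qed

lemma independent_of_order_mono:
  "\<F> \<subseteq> \<G> \<Longrightarrow> independent_of_order M T \<F> k \<Longrightarrow> independent_of_order M T \<G> k"
  unfolding independent_of_order_def by blast

theorem theorem6p1:
  fixes M :: "'a measure" and T :: "'a \<Rightarrow> 'a"
  assumes "mds M T"
  shows "(weakly_mixing M T \<longleftrightarrow> independent_of_order M T family_inf 2) \<and>
    (weakly_mixing M T \<longleftrightarrow> independent_all_orders M T family_inf) \<and>
    (weakly_mixing M T \<longleftrightarrow> independent_of_order M T family_ip 2) \<and>
    (weakly_mixing M T \<longleftrightarrow> independent_all_orders M T family_ip)"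
proof -
  interpret measure_preserving M T
    using assms by (rule mds_imp_measure_preserving)
  have ip: "independent_all_orders M T family_ip" if "weakly_mixing M T"
    using weakly_mixing_imp_IP_independent[OF that] by (simp add: independent_all_orders_def)
  have wm: "weakly_mixing M T" if "independent_of_order M T family_inf 2"
    using hitting_times_Int_if_independent[OF that] by (rule weakly_mixing_if_simultaneous_hits)
  have "independent_all_orders M T \<F> \<Longrightarrow> independent_of_order M T \<F> 2" for \<F>
    by (simp add: independent_all_orders_def)
  moreover have "independent_all_orders M T family_ip \<Longrightarrow> independent_all_orders M T family_inf"
    unfolding independent_all_orders_def
    using independent_of_order_mono[OF family_ip_subset_family_inf] by blast
  ultimately show ?thesis
    using ip wm independent_of_order_mono[OF family_ip_subset_family_inf] by blast
qed

end
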